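(* Let $0\le a<b<\infty$, let $k>1$, and let $p,q>0$ be real numbers. Let $f:[a,b]\to\mathbb{R}$ be continuous on $[a,b]$ with $f\in L([a,b])$. If $|f|^{\frac{k}{k-1}}$ is quasi-convex on $[a,b]$, then $$\int_a^b (x-a)^p(b-x)^q f(x)\,dx\le (b-a)^{p+q+1}\left[\beta(kp+1,kq+1)\right]^{\frac1k}\left(\max\left\{|f(a)|^{\frac{k}{k-1}},|f(b)|^{\frac{k}{k-1}}\right\}\right)^{\frac{k-1}{k}}.$$
   Context: A function $g:[a,b]\to\mathbb{R}$ is quasi-convex on $[a,b]$ if $g(\lambda x+(1-\lambda)y)\le\max\{g(x),g(y)\}$ for all $x,y\in[a,b]$ and $\lambda\in[0,1]$. $L([a,b])$ denotes the integrable functions on $[a,b]$. $\beta(x,y)=\int_0^1 t^{x-1}(1-t)^{y-1}\,dt$ ($x,y>0$) is the Euler Beta function. *)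

theory Defs
  imports "HOL-Analysis.Analysis"
begin

definition quasi_convex_on :: "real set \<Rightarrow> (real \<Rightarrow> real) \<Rightarrow> bool" where
  "quasi_convex_on S g \<longleftrightarrow>
     convex S \<and> (\<forall>x\<in>S. \<forall>y\<in>S. \<forall>t\<in>{0..1}. g (t * x + (1 - t) * y) \<le> max (g x) (g y))"

text \<open>The library defines Beta through the Gamma function; for positive real arguments it is
  the Euler integral.\<close>

lemma Beta_eq_integral:
  fixes x y :: real
  assumes "x > 0" "y > 0"
  shows "Beta x y = integral {0..1} (\<lambda>t. t powr (x - 1) * (1 - t) powr (y - 1))"
  using has_integral_Beta_real[OF assms] by (simp add: integral_unique)

end

theory Submission
  imports Defs
begin

text \<open>Quasi-convexity bounds \<open>\<bar>f\<bar>\<close> on \<open>[a, b]\<close> by its maximum \<open>M\<close> at the endpoints, so the integral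
  is at most \<open>M (b - a)\<^bsup>p+q+1\<^esup> \<beta>(p+1, q+1)\<close>. Since \<open>[0, 1]\<close> has measure 1, the \<open>L\<^sup>1\<close> norm of
  \<open>t\<^sup>p (1-t)\<^sup>q\<close> is at most its \<open>L\<^sup>k\<close> norm, that is \<open>\<beta>(p+1, q+1) \<le> \<beta>(kp+1, kq+1)\<^bsup>1/k\<^esup>\<close>.\<close>

text \<open>Dividing \<open>h\<close> by \<open>c\<close>, the \<open>k\<close>-th root of
  \<open>J\<close>, makes the integral of its \<open>k\<close>-th power 1. Young's inequality
  against the constant 1 then integrates to \<open>I / c\<close> \<le>
  \<open>1 / k + (1 - 1 / k)\<close>.\<close>

lemma integral_le_powr_mean:
  fixes h :: "real \<Rightarrow> real"
  assumes "k > 1" "J > 0" "\<And>t. t \<in> {0..1} \<Longrightarrow> h t \<ge> 0"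
    and I: "(h has_integral I) {0..1}"
    and J: "((\<lambda>t. h t powr k) has_integral J) {0..1}"
  shows "I \<le> J powr (1 / k)"
proof -
  define c where "c = J powr (1 / k)"
  have c: "c > 0" "c powr k = J"
    using assms(1,2) by (simp_all add: c_def powr_powr)
  have "((\<lambda>t. h t / c) has_integral I / c) {0..1}"
    using I by (rule has_integral_divide)
  moreover have "((\<lambda>t. h t powr k / (k * J) + (1 - 1 / k)) has_integral J / (k * J) + (1 - 1 / k)) {0..1}"
    by (intro has_integral_add has_integral_divide J)
      (use has_integral_const_real[of "1 - 1 / k" 0 1] in simp)
  moreover have "h t / c \<le> h t powr k / (k * J) + (1 - 1 / k)" if "t \<in> {0..1}" for t
  proof -
    \<comment> \<open>The conjugate exponent of \<open>k\<close> is \<open>k / (k - 1)\<close>,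
      whose reciprocal is \<open>1 - 1 / k\<close>.\<close>
    have "h t / c * 1 \<le> (h t / c) powr k / k + 1 powr (k / (k - 1)) / (k / (k - 1))"
      using assms(1,3) c(1) that by (intro Youngs_inequality) (auto simp: field_simps)
    also have "(h t / c) powr k = h t powr k / J"
      using assms(3) c that by (simp add: powr_divide)
    finally show ?thesis
      using assms(1) by (simp add: field_simps)
  qed
  ultimately have "I / c \<le> J / (k * J) + (1 - 1 / k)"
    by (rule has_integral_le)
  also have "\<dots> = 1"
    using assms(1,2) by (simp add: field_simps)
  finally show ?thesis
    using c(1) by (simp add: c_def field_simps)
qed

lemma Beta_le_powr:
  fixes p q k :: real
  assumes "k > 1" "p > 0" "q > 0"
  shows "Beta (p + 1) (q + 1) \<le> Beta (k * p + 1) (k * q + 1) powr (1 / k)"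
proof (rule integral_le_powr_mean)
  have "k * p > 0" "k * q > 0"
    using assms by auto
  then show "Beta (k * p + 1) (k * q + 1) > 0"
    by (simp add: Beta_def)
  show "((\<lambda>t. t powr p * (1 - t) powr q) has_integral Beta (p + 1) (q + 1)) {0..1}"
    using has_integral_Beta_real[of "p + 1" "q + 1"] assms by simp
  have "((\<lambda>t. t powr (k * p) * (1 - t) powr (k * q)) has_integral Beta (k * p + 1) (k * q + 1)) {0..1}"
    using has_integral_Beta_real[of "k * p + 1" "k * q + 1"] \<open>k * p > 0\<close> \<open>k * q > 0\<close> by simp
  then show "((\<lambda>t. (t powr p * (1 - t) powr q) powr k) has_integral Beta (k * p + 1) (k * q + 1)) {0..1}"
    by (rule has_integral_eq[rotated]) (simp add: powr_mult powr_powr mult.commute)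
qed (use assms in auto)

text \<open>Substitute \<open>t = (x - a) / (b - a)\<close> in the Euler integral: the Jacobian
  contributes one factor \<open>b - a\<close>, the rescaled powers contribute \<open>p + q\<close>
  more.\<close>

lemma has_integral_Beta_Icc:
  fixes a b p q :: real
  assumes "a < b" "p > -1" "q > -1"
  shows "((\<lambda>x. (x - a) powr p * (b - x) powr q)
    has_integral (b - a) powr (p + q + 1) * Beta (p + 1) (q + 1)) {a..b}"
proof -
  define d where "d = b - a"
  have d: "d > 0" "b = a + d"
    using assms by (simp_all add: d_def)
  have "((\<lambda>t. t powr p * (1 - t) powr q) has_integral Beta (p + 1) (q + 1)) (cbox 0 1)"
    using has_integral_Beta_real[of "p + 1" "q + 1"] assms by simp
  \<comment> \<open>This is the right endpoint in the form that the affine substitution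
    produces.\<close>
  moreover have "d * (1 + a / d) = b"
    using d by (simp add: field_simps)
  moreover note d
  ultimately have "((\<lambda>x. ((x - a) / d) powr p * (1 - (x - a) / d) powr q)
      has_integral d * Beta (p + 1) (q + 1)) {a..b}"
    using has_integral_affinity'[of "\<lambda>t. t powr p * (1 - t) powr q" "Beta (p + 1) (q + 1)" 0 1 "1 / d" "- a / d"]
    by (simp add: diff_divide_distrib)
  from has_integral_mult_right[OF this, of "d powr (p + q)"]
  have "((\<lambda>x. d powr (p + q) * (((x - a) / d) powr p * (1 - (x - a) / d) powr q))
      has_integral d powr (p + q + 1) * Beta (p + 1) (q + 1)) {a..b}"
    using d by (simp add: powr_add mult_ac)
  moreover have "d powr (p + q) * (((x - a) / d) powr p * (1 - (x - a) / d) powr q)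
      = (x - a) powr p * (b - x) powr q" if "x \<in> {a..b}" for x
  proof -
    have "1 - (x - a) / d = (b - x) / d"
      using d by (simp add: field_simps)
    then show ?thesis
      using d(1) that by (simp add: powr_divide powr_add)
  qed
  ultimately show ?thesis
    unfolding d_def by (rule has_integral_eq[rotated])
qed

lemma quasi_convex_on_Icc_le:
  assumes "quasi_convex_on {a..b} g" "x \<in> {a..b}"
  shows "g x \<le> max (g a) (g b)"
proof -
  have "x \<in> closed_segment a b"
    using assms(2) by (simp add: closed_segment_eq_real_ivl)
  then obtain u where "x = (1 - u) * a + u * b" "0 \<le> u" "u \<le> 1"
    by (auto simp: closed_segment_def)
  \<comment> \<open>\<open>quasi_convex_on\<close> puts its weight on the first point, so it is used
    with \<open>t = 1 - u\<close>.\<close>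
  moreover have "g ((1 - u) * a + (1 - (1 - u)) * b) \<le> max (g a) (g b)"
    if "0 \<le> u" "u \<le> 1"
  proof -
    have "a \<in> {a..b}" "b \<in> {a..b}" "1 - u \<in> {0..1}"
      using assms(2) that by auto
    then show ?thesis
      using assms(1) unfolding quasi_convex_on_def by blast
  qed
  ultimately show ?thesis
    by simp
qed

theorem theorem3p1:
  fixes f :: "real \<Rightarrow> real" and a b k p q :: real
  assumes "0 \<le> a" and "a < b" and "k > 1" and "p > 0" and "q > 0"
    and "continuous_on {a..b} f"
    and "f absolutely_integrable_on {a..b}"
    and "quasi_convex_on {a..b} (\<lambda>x. \<bar>f x\<bar> powr (k / (k - 1)))"
  shows "integral {a..b} (\<lambda>x. (x - a) powr p * (b - x) powr q * f x)
    \<le> (b - a) powr (p + q + 1) * Beta (k * p + 1) (k * q + 1) powr (1 / k)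
       * max (\<bar>f a\<bar> powr (k / (k - 1))) (\<bar>f b\<bar> powr (k / (k - 1))) powr ((k - 1) / k)"
proof -
  define M where "M = max (\<bar>f a\<bar> powr (k / (k - 1))) (\<bar>f b\<bar> powr (k / (k - 1))) powr ((k - 1) / k)"
  have M: "f x \<le> M" if "x \<in> {a..b}" for x
  proof -
    \<comment> \<open>The two exponents are reciprocal, so the endpoint bound passes to
      \<open>\<bar>f x\<bar>\<close> by monotonicity of the outer power.\<close>
    have "\<bar>f x\<bar> = (\<bar>f x\<bar> powr (k / (k - 1))) powr ((k - 1) / k)"
      using assms(3) by (simp add: powr_powr)
    also have "\<dots> \<le> M"
      unfolding M_def using quasi_convex_on_Icc_le[OF assms(8) that] assms(3)
      by (intro powr_mono2) auto
    finally show ?thesis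
      by simp
  qed
  \<comment> \<open>Positive exponents keep the powers continuous at the endpoints, where a base
    vanishes.\<close>
  have "continuous_on {a..b} (\<lambda>x. (x - a) powr p * (b - x) powr q * f x)"
    using assms(4,5,6) by (intro continuous_intros continuous_on_powr') auto
  then have "(\<lambda>x. (x - a) powr p * (b - x) powr q * f x) integrable_on {a..b}"
    by (rule integrable_continuous_real)
  moreover have W: "((\<lambda>x. (x - a) powr p * (b - x) powr q * M)
      has_integral (b - a) powr (p + q + 1) * Beta (p + 1) (q + 1) * M) {a..b}"
    using has_integral_Beta_Icc assms(2,4,5) by (intro has_integral_mult_left) auto
  ultimately have "integral {a..b} (\<lambda>x. (x - a) powr p * (b - x) powr q * f x)
      \<le> (b - a) powr (p + q + 1) * Beta (p + 1) (q + 1) * M"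
    using M by (intro has_integral_le[OF integrable_integral W] mult_left_mono) auto
  \<comment> \<open>Being a \<open>powr\<close> value, \<open>M\<close> is nonnegative, so
    multiplying by it preserves the inequality.\<close>
  also have "\<dots> \<le> (b - a) powr (p + q + 1) * Beta (k * p + 1) (k * q + 1) powr (1 / k) * M"
    using Beta_le_powr assms(3,4,5) by (intro mult_right_mono mult_left_mono) (auto simp: M_def)
  finally show ?thesis
    by (simp add: M_def)
qed

end
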